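(* Let $I=\{0\}$ or $I=\mathbb{Z}/d\mathbb{Z}$ for a positive integer $d$ (with addition in $I$; $0+0=0$ and $i+l$ is read as $0$ when $I=\{0\}$). Let $m\in\{2,3,4,\dots\}\cup\{\infty\}$ and let $J_m=\{0,\dots,m-1\}$ if $m$ is finite, $J_m=\mathbb{N}=\{0,1,2,\dots\}$ if $m=\infty$. Suppose the free abelian group with basis the symbols $[i,u]$, $(i,u)\in I\times J_m$, with addition denoted $\oplus$, is equipped with a multiplication $\otimes$ making it a ring. Put $[i,u]=0$ if $u<0$. Assume that for all $i,j\in I$ the following relations hold, and also hold with the two factors of each product on the left-hand side interchanged: (a) $[i,0]\otimes[j,0]=[i+j,0]$; (b) $[0,1]\otimes[j,v]=[j,v+1]\oplus[j+1,v-1]$ for all integers $0\le v\le m-2$ (all $v\in\mathbb{N}$ if $m=\infty$); (c) if $m$ is finite, $[0,1]\otimes[j,m-1]=[j,m-1]\oplus[j+1,m-1]$. Then for all $i,j\in I$ and $u,v\in J_m$: 1. if $u+v\le m-1$, then $[i,u]\otimes[j,v]=\bigoplus_{l=0}^{\min(u,v)}[i+j+l,\,u+v-2l]$; 2. if $u+v\ge m-1$, then, with $e=u+v-(m-1)$, $$[i,u]\otimes[j,v]=\bigoplus_{l=0}^{e}[i+j+l,\,m-1]\ \oplus\bigoplus_{l=e+1}^{\min(u,v)}[i+j+l,\,u+v-2l].$$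
   Context: Here $\bigoplus$ denotes the finite sum in the given ring, and an empty sum is $0$. If $m=\infty$, only case 1 occurs. *)

theory Defs
  imports
    "HOL-Algebra.Ring"
    "HOL-Algebra.Elementary_Groups"
    "HOL-Algebra.Free_Abelian_Groups"
    "HOL-Library.Extended_Nat"
begin

datatype index_kind = Trivial | Cyclic nat

text \<open>
  \<^term>\<open>integer_mod_group 0\<close> is the infinite cyclic group of integers, so a
  finite index set \<open>Cyclic d\<close> needs \<open>d > 0\<close>.
\<close>

fun valid_index_kind :: "index_kind \<Rightarrow> bool" where
  "valid_index_kind Trivial \<longleftrightarrow> True"
| "valid_index_kind (Cyclic d) \<longleftrightarrow> d > 0"

fun index_group :: "index_kind \<Rightarrow> int monoid" where
  "index_group Trivial = singleton_group 0"
| "index_group (Cyclic d) = integer_mod_group d"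

text \<open>The element of the index group denoted by the natural number \<open>l\<close> in \<open>i + l\<close>.\<close>

fun index_of_nat :: "index_kind \<Rightarrow> nat \<Rightarrow> int" where
  "index_of_nat Trivial l = 0"
| "index_of_nat (Cyclic d) l = int l mod int d"

definition index_set :: "index_kind \<Rightarrow> int set" where
  "index_set K = carrier (index_group K)"

definition index_add :: "index_kind \<Rightarrow> int \<Rightarrow> int \<Rightarrow> int" where
  "index_add K i j = i \<otimes>\<^bsub>index_group K\<^esub> j"

definition index_shift :: "index_kind \<Rightarrow> int \<Rightarrow> nat \<Rightarrow> int" where
  "index_shift K i l = index_add K i (index_of_nat K l)"

definition levels :: "enat \<Rightarrow> nat set" where
  "levels m = {u. enat u < m}"

text \<open>
  The symbol \<open>[i, u]\<close>. The level is an integer so that \<open>[i, u] = 0\<close> for negative \<open>u\<close>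
  makes sense; for \<open>u \<ge> 0\<close> it is the basis element \<open>(i, u)\<close> of the free abelian group.
\<close>

definition bsym :: "int \<Rightarrow> int \<Rightarrow> (int \<times> nat) \<Rightarrow>\<^sub>0 int" where
  "bsym i u = (if u < 0 then 0 else frag_of (i, nat u))"

end

theory Submission
  imports Defs
begin

text \<open>
  The ring is governed by two commuting elements, the shift \<open>s = [1, 0]\<close> and \<open>x = [0, 1]\<close>.
  Relation (b) is a three-term recurrence \<open>[j, v + 2] = x [j, v + 1] - [j + 1, v]\<close>, so that
  \<open>[j, v] = [j, 0] D v\<close> for \<open>v < m\<close>, where \<open>D\<close> solves \<open>D (v + 2) = x D (v + 1) - s D v\<close> with
  \<open>D 0 = 1\<close> and \<open>D 1 = x\<close> (lemma \<open>B_eq\<close> inside the final proof). The elements \<open>D v\<close> make sense for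
  all \<open>v\<close>, also beyond the last level, and they obey the Clebsch-Gordan rule
  \<open>D u D v = \<Sum>l \<le> min u v. s ^ l D (u + v - 2 l)\<close> (\<open>dickson_mult\<close>), as the characters of \<open>SL\<^sub>2\<close> do.
  Since \<open>[j, 0]\<close> commutes with \<open>D u\<close>, and \<open>[i, 0] [j, 0] s ^ l = [i + j + l, 0]\<close>, case 1 is this rule
  multiplied by \<open>[i + j, 0]\<close>.

  For finite \<open>m\<close> with \<open>N = m - 1\<close> and \<open>e = u + v - N \<ge> 0\<close>, the first \<open>e + 1\<close> terms of the rule
  have the indices \<open>N + e, N + e - 2, \<dots>, N - e\<close>, which lie symmetrically around the last level and
  partly beyond it. They need not be computed one by one: by the same rule applied to
  \<open>e\<close> and \<open>N\<close>, whose sum is also \<open>u + v\<close>, they add up to \<open>D e D N\<close>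
  (\<open>dickson_mult_truncated\<close>). Relation (c) says that \<open>x\<close> acts on \<open>y = [k, N]\<close> as
  \<open>1 + s\<close>, and \<open>D e\<close> evaluated at \<open>x = 1 + s\<close> is the geometric sum \<open>1 + s + \<dots> + s ^ e\<close>
  (\<open>dickson_eigenvector\<close>). Hence \<open>D e [k, N] = \<Sum>l \<le> e. [k + l, N]\<close>, which is the first sum of case 2.
\<close>

section \<open>Dickson polynomials at two commuting ring elements\<close>

text \<open>
  The Dickson polynomials of the second kind \<open>E\<^sub>n(x, s)\<close>; for \<open>s = 1\<close> they are the Chebyshev
  polynomials of the second kind in \<open>x / 2\<close>.
\<close>

fun dickson :: "('a, 'b) ring_scheme \<Rightarrow> 'a \<Rightarrow> 'a \<Rightarrow> nat \<Rightarrow> 'a" where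
  "dickson R s x 0 = \<one>\<^bsub>R\<^esub>"
| "dickson R s x (Suc 0) = x"
| "dickson R s x (Suc (Suc n)) =
     x \<otimes>\<^bsub>R\<^esub> dickson R s x (Suc n) \<ominus>\<^bsub>R\<^esub> s \<otimes>\<^bsub>R\<^esub> dickson R s x n"

locale commuting_pair = ring +
  fixes s x
  assumes s_closed [simp, intro]: "s \<in> carrier R"
    and x_closed [simp, intro]: "x \<in> carrier R"
    and comm: "s \<otimes> x = x \<otimes> s"
begin

abbreviation D :: "nat \<Rightarrow> 'a" where "D \<equiv> dickson R s x"

lemma D_closed [simp, intro]: "D n \<in> carrier R"
  by (induction n rule: induct_nat_012) auto

lemma x_D: "x \<otimes> D (Suc n) = D (Suc (Suc n)) \<oplus> s \<otimes> D n"
  by (simp add: minus_eq a_assoc l_neg)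

text \<open>Each \<open>D n\<close> is a polynomial in \<open>s\<close> and \<open>x\<close>, so whatever commutes with these two
  commutes with it.\<close>

lemma commute_D:
  assumes t: "t \<in> carrier R" and ts: "t \<otimes> s = s \<otimes> t" and tx: "t \<otimes> x = x \<otimes> t"
  shows "t \<otimes> D n = D n \<otimes> t"
proof (induction n rule: induct_nat_012)
  case (ge2 n)
  have "t \<otimes> (x \<otimes> D (Suc n)) = x \<otimes> D (Suc n) \<otimes> t"
    by (metis D_closed ge2(2) m_assoc t tx x_closed)
  moreover have "t \<otimes> (s \<otimes> D n) = s \<otimes> D n \<otimes> t"
    by (metis D_closed ge2(1) m_assoc t ts s_closed)
  ultimately show ?case
    using t by (simp add: minus_eq r_distr l_distr r_minus l_minus)
qed (use t tx in simp_all)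

lemma x_pow_s: "x \<otimes> s [^] (l::nat) = s [^] l \<otimes> x"
  by (metis comm pow_mult_distrib group_commutes_pow s_closed x_closed)

text \<open>
  The recurrence applied to every summand. The bound on \<open>n\<close> keeps all the indices \<open>M - 2 * l\<close>
  positive, so that the recurrence is available and no subtraction on naturals is cut off.
\<close>

lemma x_dickson_sum:
  assumes "2 * n + 1 \<le> M"
  shows "x \<otimes> (\<Oplus>l\<in>{..n}. s [^] l \<otimes> D (M - 2 * l))
    = (\<Oplus>l\<in>{..n}. s [^] l \<otimes> D (M + 1 - 2 * l))
      \<oplus> s \<otimes> (\<Oplus>l\<in>{..n}. s [^] l \<otimes> D (M - 1 - 2 * l))"
proof -
  have summand: "x \<otimes> (s [^] l \<otimes> D (M - 2 * l))
    = s [^] l \<otimes> D (M + 1 - 2 * l) \<oplus> s \<otimes> (s [^] l \<otimes> D (M - 1 - 2 * l))"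
    if "l \<le> n" for l
  proof -
    define k where "k = M - 1 - 2 * l"
    have k: "M - 2 * l = Suc k" "M + 1 - 2 * l = Suc (Suc k)" "M - 1 - 2 * l = k"
      using that assms by (auto simp: k_def)
    have "x \<otimes> (s [^] l \<otimes> D (Suc k)) = s [^] l \<otimes> (x \<otimes> D (Suc k))"
      by (metis D_closed m_assoc nat_pow_closed s_closed x_closed x_pow_s)
    also have "\<dots> = s [^] l \<otimes> D (Suc (Suc k)) \<oplus> (s [^] l \<otimes> s) \<otimes> D k"
      by (simp only: x_D) (simp add: r_distr m_assoc del: dickson.simps)
    also have "s [^] l \<otimes> s = s \<otimes> s [^] l"
      by (simp add: group_commutes_pow)
    also have "(s \<otimes> s [^] l) \<otimes> D k = s \<otimes> (s [^] l \<otimes> D k)"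
      by (simp add: m_assoc)
    finally show ?thesis
      by (simp only: k)
  qed
  have "x \<otimes> (\<Oplus>l\<in>{..n}. s [^] l \<otimes> D (M - 2 * l))
      = (\<Oplus>l\<in>{..n}. x \<otimes> (s [^] l \<otimes> D (M - 2 * l)))"
    by (intro finsum_rdistr) auto
  also have "\<dots> = (\<Oplus>l\<in>{..n}. s [^] l \<otimes> D (M + 1 - 2 * l) \<oplus> s \<otimes> (s [^] l \<otimes> D (M - 1 - 2 * l)))"
    by (intro finsum_cong') (use summand in auto)
  also have "\<dots> = (\<Oplus>l\<in>{..n}. s [^] l \<otimes> D (M + 1 - 2 * l))
      \<oplus> (\<Oplus>l\<in>{..n}. s \<otimes> (s [^] l \<otimes> D (M - 1 - 2 * l)))"
    by (intro finsum_addf) auto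
  also have "(\<Oplus>l\<in>{..n}. s \<otimes> (s [^] l \<otimes> D (M - 1 - 2 * l)))
      = s \<otimes> (\<Oplus>l\<in>{..n}. s [^] l \<otimes> D (M - 1 - 2 * l))"
    by (intro finsum_rdistr[symmetric]) auto
  finally show ?thesis .
qed

text \<open>
  Both sides satisfy the recurrence \<open>x F (u + 1) = F (u + 2) + s F u\<close> in \<open>u\<close>. For the right-hand side
  this is the termwise recurrence except at the end of the range of summation, which depends
  on how \<open>u\<close> compares with \<open>v\<close>.
\<close>

theorem dickson_mult:
  "D u \<otimes> D v = (\<Oplus>l\<in>{..min u v}. s [^] l \<otimes> D (u + v - 2 * l))"
proof (induction u rule: induct_nat_012)
  case 0
  show ?case by simp
next
  case 1
  show ?case
    by (cases v) (simp_all add: x_D a_comm del: dickson.simps(3))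
next
  case (ge2 u)
  define F where "F u = (\<Oplus>l\<in>{..min u v}. s [^] l \<otimes> D (u + v - 2 * l))" for u
  have F: "F w \<in> carrier R" for w
    by (simp add: F_def Pi_def)
  have step: "x \<otimes> F (Suc u) = F (Suc (Suc u)) \<oplus> s \<otimes> F u"
  proof -
    consider (less) "Suc u < v" | (eq) "v = Suc u" | (greater) "v \<le> u" by linarith
    then show ?thesis
    proof cases
      case less
      \<comment> \<open>The upper bounds are \<open>u\<close>, \<open>u + 1\<close>, \<open>u + 2\<close>: the last term that the recurrence produces
        with a factor \<open>s\<close> is the last term of \<open>F (u + 2)\<close>.\<close>
      define G where "G l = s [^] l \<otimes> D (u + 2 + v - 2 * l)" for l
      define H where "H l = s [^] l \<otimes> D (u + v - 2 * l)" for l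
      have GH: "G l \<in> carrier R" "H l \<in> carrier R" for l
        by (simp_all add: G_def H_def)
      have top: "G (Suc (Suc u)) = s \<otimes> H (Suc u)"
        using less by (simp add: G_def H_def m_assoc group_commutes_pow[of s s])
      have "x \<otimes> F (Suc u) = (\<Oplus>l\<in>{..Suc u}. G l) \<oplus> s \<otimes> (\<Oplus>l\<in>{..Suc u}. H l)"
        unfolding F_def G_def H_def using x_dickson_sum[of "Suc u" "Suc u + v"] less
        by (simp add: min_def)
      also have "\<dots> = (G (Suc (Suc u)) \<oplus> (\<Oplus>l\<in>{..Suc u}. G l)) \<oplus> s \<otimes> (\<Oplus>l\<in>{..u}. H l)"
        using GH by (simp add: top Pi_def r_distr a_ac)
      also have "\<dots> = (\<Oplus>l\<in>{..Suc (Suc u)}. G l) \<oplus> s \<otimes> (\<Oplus>l\<in>{..u}. H l)"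
        using GH by (simp add: Pi_def)
      also have "\<dots> = F (Suc (Suc u)) \<oplus> s \<otimes> F u"
        using less by (simp add: F_def G_def H_def min_def)
      finally show ?thesis .
    next
      case eq
      \<comment> \<open>The last term of \<open>F (u + 1)\<close> contains \<open>D 0\<close>, to which the recurrence does not apply;
        since \<open>x D 0 = D 1\<close>, it contributes to \<open>F (u + 2)\<close> only.\<close>
      have idx: "u + v = 2 * u + 1" "Suc u + v = 2 * u + 2" "Suc (Suc u) + v = 2 * u + 3"
        "min u v = u" "min (Suc u) v = Suc u" "min (Suc (Suc u)) v = Suc u"
        using eq by auto
      define G where "G l = s [^] l \<otimes> D (2 * u + 3 - 2 * l)" for l
      define H where "H l = s [^] l \<otimes> D (2 * u + 2 - 2 * l)" for l
      have GH: "G l \<in> carrier R" "H l \<in> carrier R" for l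
        by (simp_all add: G_def H_def)
      have top: "x \<otimes> H (Suc u) = G (Suc u)"
        using x_pow_s[of "Suc u"] by (simp add: G_def H_def)
      have "x \<otimes> F (Suc u) = x \<otimes> (\<Oplus>l\<in>{..Suc u}. H l)"
        by (simp only: F_def H_def idx)
      also have "\<dots> = G (Suc u) \<oplus> x \<otimes> (\<Oplus>l\<in>{..u}. H l)"
        using GH by (simp add: Pi_def r_distr top)
      also have "x \<otimes> (\<Oplus>l\<in>{..u}. H l) = (\<Oplus>l\<in>{..u}. G l) \<oplus> s \<otimes> F u"
        using x_dickson_sum[of u "2 * u + 2"]
        by (simp add: F_def[of u] idx G_def H_def numeral_3_eq_3)
      also have "G (Suc u) \<oplus> \<dots> = F (Suc (Suc u)) \<oplus> s \<otimes> F u"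
      proof -
        have "F (Suc (Suc u)) = G (Suc u) \<oplus> (\<Oplus>l\<in>{..u}. G l)"
          unfolding F_def idx G_def[symmetric] using GH by (simp add: Pi_def)
        then show ?thesis using GH F by (simp add: Pi_def a_assoc)
      qed
      finally show ?thesis .
    next
      case greater
      \<comment> \<open>All three sums run up to \<open>v\<close>.\<close>
      then show ?thesis
        using x_dickson_sum[of v "Suc u + v"] by (simp add: F_def min_def)
    qed
  qed
  have "D (Suc (Suc u)) \<otimes> D v = x \<otimes> (D (Suc u) \<otimes> D v) \<ominus> s \<otimes> (D u \<otimes> D v)"
    by (simp add: minus_eq l_distr l_minus m_assoc)
  also have "\<dots> = x \<otimes> F (Suc u) \<ominus> s \<otimes> F u"
    using ge2 by (simp add: F_def)
  also have "\<dots> = F (Suc (Suc u))"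
    using F by (simp add: step minus_eq a_assoc r_neg)
  finally show ?case by (simp add: F_def)
qed

text \<open>
  The geometric sums of \<open>s\<close> satisfy the Dickson recurrence at \<open>x = 1 + s\<close>, because \<open>1\<close> and \<open>s\<close> are
  the roots of \<open>T\<^sup>2 - (1 + s) T + s\<close>.
\<close>

lemma dickson_eigenvector:
  assumes y: "y \<in> carrier R" and eig: "x \<otimes> y = y \<oplus> s \<otimes> y"
  shows "D e \<otimes> y = (\<Oplus>l\<in>{..e}. s [^] l \<otimes> y)"
proof (induction e rule: induct_nat_012)
  case (ge2 e)
  define S where "S e = (\<Oplus>l\<in>{..e}. s [^] l \<otimes> y)" for e :: nat
  have S: "S e \<in> carrier R" for e
    using y by (simp add: S_def Pi_def)
  have x_S: "x \<otimes> S (Suc e) = S (Suc (Suc e)) \<oplus> s \<otimes> S e"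
  proof -
    have summand: "x \<otimes> (s [^] l \<otimes> y) = s [^] l \<otimes> y \<oplus> s \<otimes> (s [^] l \<otimes> y)" for l :: nat
    proof -
      have "x \<otimes> (s [^] l \<otimes> y) = s [^] l \<otimes> (x \<otimes> y)"
        by (metis y m_assoc nat_pow_closed s_closed x_closed x_pow_s)
      also have "\<dots> = s [^] l \<otimes> y \<oplus> (s [^] l \<otimes> s) \<otimes> y"
        using y by (simp add: eig r_distr m_assoc)
      also have "s [^] l \<otimes> s = s \<otimes> s [^] l"
        by (simp add: group_commutes_pow)
      finally show ?thesis using y by (simp add: m_assoc)
    qed
    have "x \<otimes> S (Suc e) = S (Suc e) \<oplus> s \<otimes> S (Suc e)"
    proof -
      have "x \<otimes> S (Suc e) = (\<Oplus>l\<in>{..Suc e}. s [^] l \<otimes> y \<oplus> s \<otimes> (s [^] l \<otimes> y))"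
        unfolding S_def using y by (simp only: finsum_rdistr[of "{..Suc e}"] summand
            finite_atMost x_closed Pi_I m_closed nat_pow_closed s_closed)
      also have "\<dots> = S (Suc e) \<oplus> s \<otimes> S (Suc e)"
        unfolding S_def using y by (simp add: finsum_rdistr Pi_def finsum_addf del: finsum_Suc)
      finally show ?thesis .
    qed
    also have "s \<otimes> S (Suc e) = s [^] Suc (Suc e) \<otimes> y \<oplus> s \<otimes> S e"
      using y by (simp add: S_def Pi_def r_distr m_assoc group_commutes_pow[of s s])
    also have "S (Suc e) \<oplus> \<dots> = S (Suc (Suc e)) \<oplus> s \<otimes> S e"
      using y S by (simp add: S_def[of "Suc (Suc e)"] S_def[of "Suc e"] Pi_def a_ac del: nat_pow_Suc)
    finally show ?thesis .
  qed
  have "D (Suc (Suc e)) \<otimes> y = x \<otimes> (D (Suc e) \<otimes> y) \<ominus> s \<otimes> (D e \<otimes> y)"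
    using y by (simp add: minus_eq l_distr l_minus m_assoc)
  also have "\<dots> = x \<otimes> S (Suc e) \<ominus> s \<otimes> S e"
    using ge2 by (simp add: S_def)
  also have "\<dots> = S (Suc (Suc e))"
    using S by (simp add: x_S minus_eq a_assoc r_neg)
  finally show ?case by (simp add: S_def)
qed (use y eig in \<open>simp_all add: Pi_def a_comm\<close>)

text \<open>
  The sums for \<open>D u D v\<close> and \<open>D (u + v - N) D N\<close> have the same summands, since these depend only
  on the sum of the two indices; the second one is merely shorter.
\<close>

corollary dickson_mult_truncated:
  assumes le: "u \<le> N" "v \<le> N" "N \<le> u + v"
  shows "D u \<otimes> D v = D (u + v - N) \<otimes> D N
    \<oplus> (\<Oplus>l\<in>{u + v - N + 1..min u v}. s [^] l \<otimes> D (u + v - 2 * l))"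
proof -
  define e where "e = u + v - N"
  have e: "e + N = u + v" "e \<le> min u v" "min e N = e"
    using le by (auto simp: e_def)
  have split: "{..min u v} = {..e} \<union> {e + 1..min u v}"
    using e by auto
  have "D u \<otimes> D v = (\<Oplus>l\<in>{..e}. s [^] l \<otimes> D (e + N - 2 * l))
      \<oplus> (\<Oplus>l\<in>{e + 1..min u v}. s [^] l \<otimes> D (u + v - 2 * l))"
    unfolding dickson_mult split e(1) by (rule finsum_Un_disjoint) auto
  then show ?thesis
    using dickson_mult[of e N] e by (simp add: e_def[symmetric])
qed

end

section \<open>Index groups and the product formula\<close>

lemma bsym_nat [simp]: "bsym i (int u) = frag_of (i, u)"
  by (simp add: bsym_def)

lemma comm_group_index_group: "comm_group (index_group K)"
  by (cases K) auto

lemma one_index_group: "\<one>\<^bsub>index_group K\<^esub> = 0"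
  by (cases K) (auto simp: singleton_group_def)

lemma index_of_nat_eq_pow:
  "index_of_nat K l = index_of_nat K 1 [^]\<^bsub>index_group K\<^esub> l"
proof (cases K)
  case Trivial
  then show ?thesis by (induction l) (auto simp: singleton_group_def)
next
  case (Cyclic d)
  then show ?thesis by (simp add: mod_mult_right_eq)
qed

lemma index_of_nat_in_carrier:
  "valid_index_kind K \<Longrightarrow> index_of_nat K l \<in> carrier (index_group K)"
  by (cases K) (auto simp: carrier_integer_mod_group)

theorem proposition3p1:
  fixes K :: index_kind and m :: enat
    and R :: "((int \<times> nat) \<Rightarrow>\<^sub>0 int) ring"
  assumes K: "valid_index_kind K"
    and m: "2 \<le> m"
    and R: "ring R"
    and free: "add_monoid R = free_Abelian_group (index_set K \<times> levels m)"
    and a: "\<And>i j. i \<in> index_set K \<Longrightarrow> j \<in> index_set K \<Longrightarrow>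
        bsym i 0 \<otimes>\<^bsub>R\<^esub> bsym j 0 = bsym (index_add K i j) 0"
    and a': "\<And>i j. i \<in> index_set K \<Longrightarrow> j \<in> index_set K \<Longrightarrow>
        bsym j 0 \<otimes>\<^bsub>R\<^esub> bsym i 0 = bsym (index_add K i j) 0"
    and b: "\<And>j (v::nat). j \<in> index_set K \<Longrightarrow> enat v \<le> m - 2 \<Longrightarrow>
        bsym 0 1 \<otimes>\<^bsub>R\<^esub> bsym j (int v)
          = bsym j (int v + 1) \<oplus>\<^bsub>R\<^esub> bsym (index_shift K j 1) (int v - 1)"
    and b': "\<And>j (v::nat). j \<in> index_set K \<Longrightarrow> enat v \<le> m - 2 \<Longrightarrow>
        bsym j (int v) \<otimes>\<^bsub>R\<^esub> bsym 0 1
          = bsym j (int v + 1) \<oplus>\<^bsub>R\<^esub> bsym (index_shift K j 1) (int v - 1)"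
    and c: "\<And>j (n::nat). m = enat n \<Longrightarrow> j \<in> index_set K \<Longrightarrow>
        bsym 0 1 \<otimes>\<^bsub>R\<^esub> bsym j (int n - 1)
          = bsym j (int n - 1) \<oplus>\<^bsub>R\<^esub> bsym (index_shift K j 1) (int n - 1)"
    and c': "\<And>j (n::nat). m = enat n \<Longrightarrow> j \<in> index_set K \<Longrightarrow>
        bsym j (int n - 1) \<otimes>\<^bsub>R\<^esub> bsym 0 1
          = bsym j (int n - 1) \<oplus>\<^bsub>R\<^esub> bsym (index_shift K j 1) (int n - 1)"
  shows "\<forall>i\<in>index_set K. \<forall>j\<in>index_set K. \<forall>u\<in>levels m. \<forall>v\<in>levels m.
      (enat (u + v) \<le> m - 1 \<longrightarrow>
        bsym i (int u) \<otimes>\<^bsub>R\<^esub> bsym j (int v)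
          = (\<Oplus>\<^bsub>R\<^esub>l\<in>{0..min u v}.
               bsym (index_shift K (index_add K i j) l) (int u + int v - 2 * int l)))
    \<and> (\<forall>n::nat. m = enat n \<and> n - 1 \<le> u + v \<longrightarrow>
        (let e = u + v - (n - 1) in
          bsym i (int u) \<otimes>\<^bsub>R\<^esub> bsym j (int v)
            = (\<Oplus>\<^bsub>R\<^esub>l\<in>{0..e}. bsym (index_shift K (index_add K i j) l) (int n - 1))
              \<oplus>\<^bsub>R\<^esub>
              (\<Oplus>\<^bsub>R\<^esub>l\<in>{e + 1..min u v}.
                 bsym (index_shift K (index_add K i j) l) (int u + int v - 2 * int l))))"
proof -
  interpret ring R by (fact R)
  interpret I: comm_group "index_group K" by (fact comm_group_index_group)
  \<comment> \<open>\<open>sh\<close> is the class of 1 in the index group, which is 0 if the group is trivial.\<close>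
  define sh where "sh = index_of_nat K 1"
  define B where "B i u = (frag_of (i, u) :: (int \<times> nat) \<Rightarrow>\<^sub>0 int)" for i u
  define s where "s = B sh 0"
  define x where "x = B 0 1"

  have add_index [simp]: "index_add K i j = i \<otimes>\<^bsub>index_group K\<^esub> j" for i j
    by (simp add: index_add_def)
  have sh [simp]: "sh \<in> carrier (index_group K)"
    using K by (simp add: sh_def index_of_nat_in_carrier)
  have shift [simp]: "index_shift K i l = i \<otimes>\<^bsub>index_group K\<^esub> sh [^]\<^bsub>index_group K\<^esub> l" for i l
    by (metis index_shift_def add_index index_of_nat_eq_pow sh_def)
  have zero_index [simp]: "0 \<in> carrier (index_group K)"
    using I.one_closed by (simp add: one_index_group)
  have [simp]: "i \<otimes>\<^bsub>index_group K\<^esub> 0 = i" "0 \<otimes>\<^bsub>index_group K\<^esub> i = i"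
    if "i \<in> carrier (index_group K)" for i
    using that I.r_one I.l_one by (simp_all add: one_index_group)
  have [simp]: "index_set K = carrier (index_group K)"
    by (simp add: index_set_def)

  have zero_R: "0 = \<zero>\<^bsub>R\<^esub>"
    using arg_cong[OF free, of one] by simp
  have carrier_R: "carrier R = carrier (free_Abelian_group (index_set K \<times> levels m))"
    using arg_cong[OF free, of carrier] by simp
  have B_closed: "B i u \<in> carrier R" if "i \<in> carrier (index_group K)" "enat u < m" for i u
    using that by (simp add: carrier_R B_def levels_def)
  have small: "enat 0 < m" "enat 1 < m" "enat 0 \<le> m - 2"
    using m by (cases m; simp add: numeral_eq_enat zero_enat_def)+
  have le_m2: "enat v \<le> m - 2 \<longleftrightarrow> enat (Suc v) < m" for v
    using m by (cases m) (auto simp: numeral_eq_enat)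
  have x_bsym: "x = bsym 0 1"
    by (simp add: x_def B_def bsym_def)

  have B00: "B i 0 \<otimes>\<^bsub>R\<^esub> B j 0 = B (i \<otimes>\<^bsub>index_group K\<^esub> j) 0"
    if "i \<in> carrier (index_group K)" "j \<in> carrier (index_group K)" for i j
    using a[of i j] that by (simp add: B_def bsym_def)
  \<comment> \<open>Relation (b) at \<open>v = 0\<close>, where the symbol of level \<open>-1\<close> vanishes. Both orders of the factors
    are required: they give the commutation of \<open>x\<close> with \<open>s\<close> and with every \<open>[i, 0]\<close>.\<close>
  have x_B0: "x \<otimes>\<^bsub>R\<^esub> B i 0 = B i 1" and B0_x: "B i 0 \<otimes>\<^bsub>R\<^esub> x = B i 1"
    if i: "i \<in> carrier (index_group K)" for i
  proof -
    have "bsym i 1 \<in> carrier R"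
      using B_closed[OF i small(2)] by (simp add: B_def bsym_def)
    then show "x \<otimes>\<^bsub>R\<^esub> B i 0 = B i 1" "B i 0 \<otimes>\<^bsub>R\<^esub> x = B i 1"
      using b[of i 0] b'[of i 0] i small(3)
      by (simp_all add: x_bsym) (simp_all add: B_def bsym_def zero_R)
  qed
  interpret commuting_pair R s x
  proof unfold_locales
    show "s \<in> carrier R" "x \<in> carrier R"
      unfolding s_def x_def by (intro B_closed small sh zero_index)+
    show "s \<otimes>\<^bsub>R\<^esub> x = x \<otimes>\<^bsub>R\<^esub> s"
      by (simp add: s_def x_B0 B0_x)
  qed
  have x_BSuc: "x \<otimes>\<^bsub>R\<^esub> B i (Suc u) = B i (Suc (Suc u)) \<oplus>\<^bsub>R\<^esub> B (i \<otimes>\<^bsub>index_group K\<^esub> sh) u"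
    if "i \<in> carrier (index_group K)" "enat (Suc (Suc u)) < m" for i u
    using b[of i "Suc u"] that
    by (simp add: x_bsym le_m2) (simp add: B_def bsym_def nat_add_distrib)

  have B0_closed [simp]: "B i 0 \<in> carrier R" if "i \<in> carrier (index_group K)" for i
    using that by (simp add: B_closed small)
  have B_eq: "B i u = B i 0 \<otimes>\<^bsub>R\<^esub> D u" if "enat u < m" "i \<in> carrier (index_group K)" for i u
    using that
  proof (induction u arbitrary: i rule: induct_nat_012)
    case (ge2 u)
    have lt: "enat u < m" "enat (Suc u) < m"
      using ge2.prems(1) by (cases m; simp)+
    have i: "i \<in> carrier (index_group K)" by fact
    note cl = B_closed[OF i ge2.prems(1)] B_closed[OF _ lt(1), of "i \<otimes>\<^bsub>index_group K\<^esub> sh"] i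
    have "B i (Suc (Suc u)) = x \<otimes>\<^bsub>R\<^esub> B i (Suc u) \<ominus>\<^bsub>R\<^esub> B (i \<otimes>\<^bsub>index_group K\<^esub> sh) u"
      using cl ge2.prems by (simp add: x_BSuc minus_eq a_assoc r_neg)
    also have "\<dots> = x \<otimes>\<^bsub>R\<^esub> (B i 0 \<otimes>\<^bsub>R\<^esub> D (Suc u)) \<ominus>\<^bsub>R\<^esub> B i 0 \<otimes>\<^bsub>R\<^esub> s \<otimes>\<^bsub>R\<^esub> D u"
      using ge2 lt i by (simp add: s_def B00)
    also have "x \<otimes>\<^bsub>R\<^esub> (B i 0 \<otimes>\<^bsub>R\<^esub> D (Suc u)) = B i 0 \<otimes>\<^bsub>R\<^esub> (x \<otimes>\<^bsub>R\<^esub> D (Suc u))"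
      using i by (simp add: m_assoc[symmetric] x_B0 B0_x)
    finally show ?case
      using i by (simp add: minus_eq r_distr r_minus m_assoc)
  qed (use B0_x in auto)

  have B0_s: "B i 0 \<otimes>\<^bsub>R\<^esub> s [^]\<^bsub>R\<^esub> l = B (i \<otimes>\<^bsub>index_group K\<^esub> sh [^]\<^bsub>index_group K\<^esub> l) 0"
    if i: "i \<in> carrier (index_group K)" for i and l :: nat
  proof (induction l)
    case (Suc l)
    have "B i 0 \<otimes>\<^bsub>R\<^esub> s [^]\<^bsub>R\<^esub> Suc l = (B i 0 \<otimes>\<^bsub>R\<^esub> s [^]\<^bsub>R\<^esub> l) \<otimes>\<^bsub>R\<^esub> s"
      using i by (simp add: m_assoc)
    then show ?case
      using Suc i by (simp add: s_def B00 I.m_assoc)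
  qed (use i in simp)
  have commute_B0: "B i 0 \<otimes>\<^bsub>R\<^esub> D u = D u \<otimes>\<^bsub>R\<^esub> B i 0" if i: "i \<in> carrier (index_group K)" for i u
    by (rule commute_D) (use i in \<open>simp_all add: x_B0 B0_x, simp add: s_def B00 I.m_comm\<close>)
  have B_mult: "B i u \<otimes>\<^bsub>R\<^esub> B j v = B (i \<otimes>\<^bsub>index_group K\<^esub> j) 0 \<otimes>\<^bsub>R\<^esub> (D u \<otimes>\<^bsub>R\<^esub> D v)"
    if ij: "i \<in> carrier (index_group K)" "j \<in> carrier (index_group K)"
      and uv: "enat u < m" "enat v < m" for i j u v
  proof -
    have "B i u \<otimes>\<^bsub>R\<^esub> B j v = B i 0 \<otimes>\<^bsub>R\<^esub> (D u \<otimes>\<^bsub>R\<^esub> B j 0) \<otimes>\<^bsub>R\<^esub> D v"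
      unfolding B_eq[OF uv(1) ij(1)] B_eq[OF uv(2) ij(2)] using ij by (simp add: m_assoc)
    also have "\<dots> = (B i 0 \<otimes>\<^bsub>R\<^esub> B j 0) \<otimes>\<^bsub>R\<^esub> (D u \<otimes>\<^bsub>R\<^esub> D v)"
      using ij by (simp only: commute_B0[symmetric]) (simp add: m_assoc)
    finally show ?thesis using ij by (simp add: B00)
  qed
  \<comment> \<open>Translates sums of Dickson polynomials back into symbols; this is where the levels have
    to stay below \<open>m\<close>.\<close>
  have B_sum: "B k 0 \<otimes>\<^bsub>R\<^esub> (\<Oplus>\<^bsub>R\<^esub>l\<in>A. s [^]\<^bsub>R\<^esub> l \<otimes>\<^bsub>R\<^esub> D (w l))
      = (\<Oplus>\<^bsub>R\<^esub>l\<in>A. B (k \<otimes>\<^bsub>index_group K\<^esub> sh [^]\<^bsub>index_group K\<^esub> l) (w l))"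
    if k: "k \<in> carrier (index_group K)" and A: "finite A" and w: "\<And>l. l \<in> A \<Longrightarrow> enat (w l) < m"
    for k w and A :: "nat set"
  proof -
    have "B k 0 \<otimes>\<^bsub>R\<^esub> (\<Oplus>\<^bsub>R\<^esub>l\<in>A. s [^]\<^bsub>R\<^esub> l \<otimes>\<^bsub>R\<^esub> D (w l))
        = (\<Oplus>\<^bsub>R\<^esub>l\<in>A. B k 0 \<otimes>\<^bsub>R\<^esub> (s [^]\<^bsub>R\<^esub> l \<otimes>\<^bsub>R\<^esub> D (w l)))"
      using k A by (simp add: finsum_rdistr Pi_def)
    also have "\<dots> = (\<Oplus>\<^bsub>R\<^esub>l\<in>A. B (k \<otimes>\<^bsub>index_group K\<^esub> sh [^]\<^bsub>index_group K\<^esub> l) (w l))"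
    proof (rule finsum_cong')
      show "(\<lambda>l. B (k \<otimes>\<^bsub>index_group K\<^esub> sh [^]\<^bsub>index_group K\<^esub> l) (w l)) \<in> A \<rightarrow> carrier R"
        using k w by (auto intro: B_closed)
      show "B k 0 \<otimes>\<^bsub>R\<^esub> (s [^]\<^bsub>R\<^esub> l \<otimes>\<^bsub>R\<^esub> D (w l)) = B (k \<otimes>\<^bsub>index_group K\<^esub> sh [^]\<^bsub>index_group K\<^esub> l) (w l)"
        if "l \<in> A" for l
        using k by (simp add: B_eq[OF w[OF that]] m_assoc[symmetric] B0_s)
    qed simp
    finally show ?thesis .
  qed

  have bsym_B: "bsym k (int u + int v - 2 * int l) = B k (u + v - 2 * l)" if "l \<le> min u v" for k u v l
    using that by (simp add: bsym_def B_def nat_diff_distrib' nat_add_distrib nat_mult_distrib)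

  show ?thesis
  proof (intro ballI conjI allI impI)
    fix i j u v
    assume "i \<in> index_set K" "j \<in> index_set K" "u \<in> levels m" "v \<in> levels m"
    then have ij: "i \<in> carrier (index_group K)" "j \<in> carrier (index_group K)"
      and uv: "enat u < m" "enat v < m"
      by (simp_all add: levels_def)
    define k where "k = i \<otimes>\<^bsub>index_group K\<^esub> j"
    have k: "k \<in> carrier (index_group K)"
      using ij by (simp add: k_def)
    have prod: "bsym i (int u) \<otimes>\<^bsub>R\<^esub> bsym j (int v) = B k 0 \<otimes>\<^bsub>R\<^esub> (D u \<otimes>\<^bsub>R\<^esub> D v)"
      using B_mult[OF ij uv] by (simp add: B_def k_def)
    {
      assume "enat (u + v) \<le> m - 1"
      then have lt: "enat (u + v - 2 * l) < m" for l
        using m by (cases m) (auto simp: one_enat_def numeral_eq_enat)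
      have "bsym i (int u) \<otimes>\<^bsub>R\<^esub> bsym j (int v)
          = (\<Oplus>\<^bsub>R\<^esub>l\<in>{..min u v}. B (k \<otimes>\<^bsub>index_group K\<^esub> sh [^]\<^bsub>index_group K\<^esub> l) (u + v - 2 * l))"
        unfolding prod dickson_mult by (rule B_sum) (use k lt in auto)
      also have "\<dots> = (\<Oplus>\<^bsub>R\<^esub>l\<in>{0..min u v}.
          bsym (index_shift K (index_add K i j) l) (int u + int v - 2 * int l))"
        by (rule finsum_cong') (use k lt in \<open>auto simp: bsym_B k_def[symmetric] intro!: B_closed\<close>)
      finally show "bsym i (int u) \<otimes>\<^bsub>R\<^esub> bsym j (int v) = (\<Oplus>\<^bsub>R\<^esub>l\<in>{0..min u v}.
          bsym (index_shift K (index_add K i j) l) (int u + int v - 2 * int l))" .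
    }
    {
      fix n
      assume n: "m = enat n \<and> n - 1 \<le> u + v"
      define N where "N = n - 1"
      define e where "e = u + v - N"
      have N: "n = Suc N" "enat N < m" "u \<le> N" "v \<le> N" "N \<le> u + v"
        using n m uv by (auto simp: N_def numeral_eq_enat)
      have bsym_N: "bsym i (int n - 1) = B i N" for i
        by (simp add: N(1) B_def)
      have lt: "enat (u + v - 2 * l) < m" if "e + 1 \<le> l" for l
        using that n N by (auto simp: e_def)
      have kN: "B k N \<in> carrier R"
        using k N by (simp add: B_closed)
      have s_kN: "s [^]\<^bsub>R\<^esub> l \<otimes>\<^bsub>R\<^esub> B k N = B (k \<otimes>\<^bsub>index_group K\<^esub> sh [^]\<^bsub>index_group K\<^esub> l) N" for l :: nat
      proof -
        have "s \<otimes>\<^bsub>R\<^esub> B k 0 = B k 0 \<otimes>\<^bsub>R\<^esub> s"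
          using k by (simp add: s_def B00 I.m_comm)
        then have "s [^]\<^bsub>R\<^esub> l \<otimes>\<^bsub>R\<^esub> B k 0 = B k 0 \<otimes>\<^bsub>R\<^esub> s [^]\<^bsub>R\<^esub> l"
          using k by (simp add: group_commutes_pow)
        then show ?thesis
          using k by (simp add: B_eq[OF N(2)] m_assoc[symmetric] B0_s)
      qed
      \<comment> \<open>Relation (c) is the eigenvector equation for \<open>[k, N]\<close>.\<close>
      have "x \<otimes>\<^bsub>R\<^esub> B k N = B k N \<oplus>\<^bsub>R\<^esub> s \<otimes>\<^bsub>R\<^esub> B k N"
        using c[of n k] n k s_kN[of 1] by (simp add: bsym_N x_bsym)
      then have "D e \<otimes>\<^bsub>R\<^esub> B k N = (\<Oplus>\<^bsub>R\<^esub>l\<in>{..e}. s [^]\<^bsub>R\<^esub> l \<otimes>\<^bsub>R\<^esub> B k N)"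
        by (rule dickson_eigenvector[OF kN])
      moreover have "B k 0 \<otimes>\<^bsub>R\<^esub> (D e \<otimes>\<^bsub>R\<^esub> D N) = D e \<otimes>\<^bsub>R\<^esub> B k N"
        unfolding B_eq[OF N(2) k] using k by (metis m_assoc commute_B0 D_closed B0_closed)
      ultimately have top: "B k 0 \<otimes>\<^bsub>R\<^esub> (D e \<otimes>\<^bsub>R\<^esub> D N)
          = (\<Oplus>\<^bsub>R\<^esub>l\<in>{0..e}. bsym (index_shift K (index_add K i j) l) (int n - 1))"
        by (simp add: s_kN bsym_N k_def[symmetric] atLeast0AtMost)
      have "B k 0 \<otimes>\<^bsub>R\<^esub> (\<Oplus>\<^bsub>R\<^esub>l\<in>{e + 1..min u v}. s [^]\<^bsub>R\<^esub> l \<otimes>\<^bsub>R\<^esub> D (u + v - 2 * l))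
          = (\<Oplus>\<^bsub>R\<^esub>l\<in>{e + 1..min u v}. B (k \<otimes>\<^bsub>index_group K\<^esub> sh [^]\<^bsub>index_group K\<^esub> l) (u + v - 2 * l))"
        by (rule B_sum) (use k lt in auto)
      also have "\<dots> = (\<Oplus>\<^bsub>R\<^esub>l\<in>{e + 1..min u v}.
                 bsym (index_shift K (index_add K i j) l) (int u + int v - 2 * int l))"
        by (rule finsum_cong') (use k lt in \<open>auto simp: bsym_B k_def[symmetric] intro!: B_closed\<close>)
      finally have rest: "B k 0 \<otimes>\<^bsub>R\<^esub> (\<Oplus>\<^bsub>R\<^esub>l\<in>{e + 1..min u v}. s [^]\<^bsub>R\<^esub> l \<otimes>\<^bsub>R\<^esub> D (u + v - 2 * l))
          = (\<Oplus>\<^bsub>R\<^esub>l\<in>{e + 1..min u v}.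
                 bsym (index_shift K (index_add K i j) l) (int u + int v - 2 * int l))" .
      have "bsym i (int u) \<otimes>\<^bsub>R\<^esub> bsym j (int v)
            = (\<Oplus>\<^bsub>R\<^esub>l\<in>{0..e}. bsym (index_shift K (index_add K i j) l) (int n - 1))
              \<oplus>\<^bsub>R\<^esub>
              (\<Oplus>\<^bsub>R\<^esub>l\<in>{e + 1..min u v}.
                 bsym (index_shift K (index_add K i j) l) (int u + int v - 2 * int l))"
        unfolding prod dickson_mult_truncated[OF N(3-5), folded e_def] top[symmetric] rest[symmetric]
        by (rule r_distr) (use k in \<open>auto intro!: finsum_closed\<close>)
      then show "let e = u + v - (n - 1) in
          bsym i (int u) \<otimes>\<^bsub>R\<^esub> bsym j (int v)
            = (\<Oplus>\<^bsub>R\<^esub>l\<in>{0..e}. bsym (index_shift K (index_add K i j) l) (int n - 1))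
              \<oplus>\<^bsub>R\<^esub>
              (\<Oplus>\<^bsub>R\<^esub>l\<in>{e + 1..min u v}.
                 bsym (index_shift K (index_add K i j) l) (int u + int v - 2 * int l))"
        by (simp only: Let_def e_def N_def)
    }
  qed
qed

end
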